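(* Let $\mathcal{P}_n$ be the set of $3$-colourings $c:E(K_n)\to[3]$ with no rainbow triangle (three vertices whose three edges receive three distinct colours). For all $n\ge3$, $\mathrm{ex}(n,\mathcal{P})=(\log_3 2)\binom n2$. Furthermore, the templates $t$ with $\langle t\rangle\subseteq\mathcal{P}_n$ and $\mathrm{Ent}(t)=(\log_32)\binom n2$ are exactly those obtained by choosing a pair of colours $\{c_1,c_2\}\subseteq[3]$ and setting $t(e)=\{c_1,c_2\}$ for every $e\in E(K_n)$.
   Context: A template for $K_n$ is $t:E(K_n)\to2^{[3]}\setminus\{\emptyset\}$, $\langle t\rangle$ is the set of colourings $c$ with $c(e)\in t(e)$ for all $e$, $\mathrm{Ent}(t)=\sum_e\log_3|t(e)|$, and $\mathrm{ex}(n,\mathcal{P})=\max\{\mathrm{Ent}(t):\langle t\rangle\subseteq\mathcal{P}_n\}$. *)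

theory Defs
  imports Complex_Main "HOL-Library.FuncSet" "HOL-Library.Ramsey"
begin

definition colours :: "nat set" where
  "colours = {1..3}"

definition Kn_edges :: "nat \<Rightarrow> nat set set" where
  "Kn_edges n = nsets {1..n} 2"

text \<open>Colourings and templates are functions on the edge set only. They are represented by
  extensional functions, so that equality of two of them means agreement on all edges of
  \<open>K\<^sub>n\<close>, and so that there are finitely many of each.\<close>

definition colourings :: "nat \<Rightarrow> (nat set \<Rightarrow> nat) set" where
  "colourings n = Kn_edges n \<rightarrow>\<^sub>E colours"

definition templates :: "nat \<Rightarrow> (nat set \<Rightarrow> nat set) set" where
  "templates n = Kn_edges n \<rightarrow>\<^sub>E (Pow colours - {{}})"

definition realisations :: "nat \<Rightarrow> (nat set \<Rightarrow> nat set) \<Rightarrow> (nat set \<Rightarrow> nat) set" where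
  "realisations n t = {c \<in> colourings n. \<forall>e \<in> Kn_edges n. c e \<in> t e}"

definition Ent :: "nat \<Rightarrow> (nat set \<Rightarrow> nat set) \<Rightarrow> real" where
  "Ent n t = (\<Sum>e \<in> Kn_edges n. log 3 (real (card (t e))))"

text \<open>The maximum ranges over a finite set; it is meaningful whenever \<open>P n\<close> is a nonempty set of
  colourings, since a single colouring is a template with singleton values.\<close>

definition ex :: "nat \<Rightarrow> (nat \<Rightarrow> (nat set \<Rightarrow> nat) set) \<Rightarrow> real" where
  "ex n P = Max {Ent n t | t. t \<in> templates n \<and> realisations n t \<subseteq> P n}"

definition rainbow_triangle :: "(nat set \<Rightarrow> nat) \<Rightarrow> nat \<Rightarrow> nat \<Rightarrow> nat \<Rightarrow> bool" where
  "rainbow_triangle c x y z \<longleftrightarrow>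
     x \<noteq> y \<and> x \<noteq> z \<and> y \<noteq> z \<and>
     c {x, y} \<noteq> c {x, z} \<and> c {x, y} \<noteq> c {y, z} \<and> c {x, z} \<noteq> c {y, z}"

definition rainbow_free :: "nat \<Rightarrow> (nat set \<Rightarrow> nat) set" where
  "rainbow_free n = {c \<in> colourings n.
     \<not> (\<exists>x \<in> {1..n}. \<exists>y \<in> {1..n}. \<exists>z \<in> {1..n}. rainbow_triangle c x y z)}"

end

theory Submission
  imports Defs
begin

text \<open>Hall's condition on one triangle shows that three nonempty subsets of \<open>[3]\<close> without a system of
  distinct representatives have sizes with product at most \<open>2\<^sup>3\<close>, with equality only for three
  copies of one pair. Averaging the logarithm of this over all triangles gives the bound, because
  every edge lies in exactly \<open>n - 2\<close> triangles. In the equality case every triangle is extremal, so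
  adjacent edges carry the same pair, and hence all edges do.\<close>

text \<open>By Hall, nonempty sets fail in two ways only: two of them are the same singleton, so the
  product is at most 3, or all three lie in one pair, so it is at most 8 with equality only if each
  is that pair.\<close>

lemma no_SDR_card_prod:
  assumes "A \<in> Pow colours - {{}}" "B \<in> Pow colours - {{}}" "C \<in> Pow colours - {{}}"
    and no_SDR: "\<And>a b c. a \<in> A \<Longrightarrow> b \<in> B \<Longrightarrow> c \<in> C \<Longrightarrow> a = b \<or> a = c \<or> b = c"
  shows "card A * card B * card C \<le> 8"
    and "card A * card B * card C = 8 \<Longrightarrow> A = B \<and> A = C \<and> card A = 2"
proof -
  have colours_eq: "colours = {1, 2, 3}"
    by (auto simp: colours_def)
  \<comment> \<open>Listing the seven admissible sets turns the claim into a finite check of 343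
    triples, so Hall's theorem itself is not invoked.\<close>
  have "Pow colours - {{}} = {{1}, {2}, {3}, {1,2}, {1,3}, {2,3}, {1,2,3}}"
    by (auto simp: colours_eq Pow_insert)
  then have "\<forall>A \<in> Pow colours - {{}}. \<forall>B \<in> Pow colours - {{}}. \<forall>C \<in> Pow colours - {{}}.
      (\<forall>a\<in>A. \<forall>b\<in>B. \<forall>c\<in>C. a = b \<or> a = c \<or> b = c) \<longrightarrow>
      card A * card B * card C \<le> 8 \<and>
      (card A * card B * card C = 8 \<longrightarrow> A = B \<and> A = C \<and> card A = 2)"
    by simp
  then have "card A * card B * card C \<le> 8 \<and>
      (card A * card B * card C = 8 \<longrightarrow> A = B \<and> A = C \<and> card A = 2)"
    using assms by blast
  then show "card A * card B * card C \<le> 8"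
    and "card A * card B * card C = 8 \<Longrightarrow> A = B \<and> A = C \<and> card A = 2"
    by blast+
qed

lemma nsets_2_triple:
  assumes "x \<noteq> y" "x \<noteq> z" "y \<noteq> z"
  shows "nsets {x, y, z} 2 = {{x, y}, {x, z}, {y, z}}"
  using assms by (auto simp: nsets_def card_2_iff)

lemma sum_nsets_2_triple:
  assumes "x \<noteq> y" "x \<noteq> z" "y \<noteq> z"
  shows "(\<Sum>e\<in>nsets {x, y, z} 2. f e) = f {x, y} + f {x, z} + (f {y, z} :: 'b::comm_monoid_add)"
  using assms by (simp add: nsets_2_triple doubleton_eq_iff add.assoc)

text \<open>Double counting of pairs inside triples. The truncated subtraction is harmless: if
  \<open>card V < 2\<close>, there are no pairs and both sides vanish.\<close>

lemma sum_nsets_3_2: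
  fixes f :: "'a set \<Rightarrow> 'b::semiring_1"
  assumes "finite V"
  shows "(\<Sum>T\<in>nsets V 3. \<Sum>e\<in>nsets T 2. f e) = of_nat (card V - 2) * (\<Sum>e\<in>nsets V 2. f e)"
proof -
  have "(\<Sum>T\<in>nsets V 3. \<Sum>e\<in>nsets T 2. f e)
      = (\<Sum>T\<in>nsets V 3. \<Sum>e | e \<in> nsets V 2 \<and> e \<subseteq> T. f e)"
    by (intro sum.cong refl) (auto simp: nsets_def)
  also have "\<dots> = (\<Sum>e\<in>nsets V 2. \<Sum>T | T \<in> nsets V 3 \<and> e \<subseteq> T. f e)"
    using assms by (intro sum.swap_restrict) (auto simp: finite_imp_finite_nsets)
  also have "\<dots> = (\<Sum>e\<in>nsets V 2. of_nat (card V - 2) * f e)"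
  proof (rule sum.cong[OF refl])
    fix e assume e: "e \<in> nsets V 2"
    then have fe: "finite e" "card e = 2" "e \<subseteq> V"
      by (auto simp: nsets_def)
    \<comment> \<open>A triple containing \<open>e\<close> is \<open>e\<close> plus one further
      vertex, and distinct vertices give distinct triples.\<close>
    have "{T \<in> nsets V 3. e \<subseteq> T} = (\<lambda>v. insert v e) ` (V - e)"
    proof (intro equalityI subsetI)
      fix T assume T: "T \<in> {T \<in> nsets V 3. e \<subseteq> T}"
      then have "card (T - e) = 1"
        using fe by (auto simp: nsets_def card_Diff_subset)
      then obtain v where "T - e = {v}"
        by (auto simp: card_1_singleton_iff)
      then show "T \<in> (\<lambda>v. insert v e) ` (V - e)"
        using T by (auto simp: nsets_def)
    qed (use fe in \<open>auto simp: nsets_def\<close>)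
    moreover have "inj_on (\<lambda>v. insert v e) (V - e)"
      by (auto simp: inj_on_def)
    ultimately have "card {T \<in> nsets V 3. e \<subseteq> T} = card V - 2"
      using fe by (simp add: card_image card_Diff_subset)
    then show "(\<Sum>T | T \<in> nsets V 3 \<and> e \<subseteq> T. f e) = of_nat (card V - 2) * f e"
      by simp
  qed
  finally show ?thesis
    by (simp add: sum_distrib_left)
qed

lemma Kn_edges_doubleton_iff: "{x, y} \<in> Kn_edges n \<longleftrightarrow> x \<in> {1..n} \<and> y \<in> {1..n} \<and> x \<noteq> y"
  by (simp add: Kn_edges_def)

lemma finite_Kn_edges: "finite (Kn_edges n)"
  by (simp add: Kn_edges_def finite_imp_finite_nsets)

lemma card_Kn_edges: "card (Kn_edges n) = n choose 2"
  by (simp add: Kn_edges_def)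

lemma finite_templates: "finite (templates n)"
  unfolding templates_def by (intro finite_PiE finite_Kn_edges) (simp add: colours_def)

text \<open>Colours on different edges are chosen independently, so three distinct choices on a
  triangle would extend to a realisation with a rainbow triangle.\<close>

lemma rainbow_free_template_no_SDR:
  assumes t: "t \<in> templates n" and rf: "realisations n t \<subseteq> rainbow_free n"
    and V: "x \<in> {1..n}" "y \<in> {1..n}" "z \<in> {1..n}" "x \<noteq> y" "x \<noteq> z" "y \<noteq> z"
    and abc: "a \<in> t {x, y}" "b \<in> t {x, z}" "c \<in> t {y, z}"
  shows "a = b \<or> a = c \<or> b = c"
proof (rule ccontr)
  assume distinct: "\<not> ?thesis"
  \<comment> \<open>The other edges take any colour of their nonempty sets; the restriction to
    \<open>Kn_edges n\<close> makes \<open>k\<close> extensional, as \<open>colourings\<close>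
    demands.\<close>
  define k where "k = (\<lambda>e \<in> Kn_edges n. if e = {x, y} then a else if e = {x, z} then b
    else if e = {y, z} then c else (SOME i. i \<in> t e))"
  have k_in: "k e \<in> t e" if "e \<in> Kn_edges n" for e
  proof -
    have "t e \<noteq> {}"
      using t that by (auto simp: templates_def)
    then show ?thesis
      using that abc by (auto simp: k_def some_in_eq)
  qed
  moreover have "t e \<subseteq> colours" if "e \<in> Kn_edges n" for e
    using t that by (auto simp: templates_def)
  moreover have "k \<in> extensional (Kn_edges n)"
    by (simp add: k_def)
  ultimately have "k \<in> realisations n t"
    by (auto simp: realisations_def colourings_def PiE_def)
  moreover have "k {x, y} = a" "k {x, z} = b" "k {y, z} = c"
    using V by (auto simp: k_def Kn_edges_doubleton_iff doubleton_eq_iff)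
  then have "rainbow_triangle k x y z"
    using V distinct by (auto simp: rainbow_triangle_def)
  ultimately show False
    using rf V by (auto simp: rainbow_free_def)
qed

text \<open>This is the logarithm of the product bound. The equality case records only the two edges
  at \<open>x\<close>, which is the form in which it is later passed from edge to edge.\<close>

lemma triangle_entropy:
  assumes t: "t \<in> templates n" and rf: "realisations n t \<subseteq> rainbow_free n"
    and V: "x \<in> {1..n}" "y \<in> {1..n}" "z \<in> {1..n}" "x \<noteq> y" "x \<noteq> z" "y \<noteq> z"
  defines "s \<equiv> \<Sum>e\<in>nsets {x, y, z} 2. log 3 (real (card (t e)))"
  shows "s \<le> 3 * log 3 2"
    and "s = 3 * log 3 2 \<Longrightarrow> t {x, y} = t {x, z} \<and> card (t {x, y}) = 2"
proof -
  let ?A = "t {x, y}" and ?B = "t {x, z}" and ?C = "t {y, z}"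
  let ?p = "card ?A * card ?B * card ?C"
  have mem: "?A \<in> Pow colours - {{}}" "?B \<in> Pow colours - {{}}" "?C \<in> Pow colours - {{}}"
    using t V unfolding templates_def by (auto simp: Kn_edges_doubleton_iff dest!: PiE_mem)
  note prod = no_SDR_card_prod[OF mem rainbow_free_template_no_SDR[OF t rf V]]
  have "card S > 0" if "S \<in> Pow colours - {{}}" for S
    using that by (auto simp: colours_def card_gt_0_iff finite_subset)
  \<comment> \<open>Positive cardinalities allow \<open>log_mult\<close> to turn the sum of
    logarithms into the logarithm of the product.\<close>
  then have pos: "card ?A > 0" "card ?B > 0" "card ?C > 0"
    using mem by blast+
  then have s: "s = log 3 (real ?p)"
    using V by (simp add: s_def sum_nsets_2_triple log_mult)
  have eight: "3 * log 3 2 = log 3 (8::real)"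
    using log_nat_power[of 2 3 3] by simp
  show "s \<le> 3 * log 3 2"
    unfolding s eight using pos prod(1) by (subst log_le_cancel_iff) (simp_all flip: of_nat_mult)
  assume "s = 3 * log 3 2"
  then have "real ?p = 8"
    unfolding s eight using pos
    by (subst (asm) inj_on_eq_iff[OF log_inj[of 3]]) (simp_all flip: of_nat_mult)
  then show "?A = ?B \<and> card ?A = 2"
    using prod(2) by linarith
qed

lemma nsets_3_triple:
  assumes "T \<in> nsets V 3"
  obtains x y z where "T = {x, y, z}" "x \<in> V" "y \<in> V" "z \<in> V" "x \<noteq> y" "x \<noteq> z" "y \<noteq> z"
  using assms by (auto simp: nsets_def card_3_iff)

text \<open>Double counting is applied to the deviation of each edge from \<open>log 3 2\<close>. As
  an exact identity it serves both the bound and the equality case.\<close>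

lemma Ent_eq_triangle_sum:
  assumes "n \<ge> 3"
  shows "(real n - 2) * (Ent n t - log 3 2 * real (n choose 2))
    = (\<Sum>T\<in>nsets {1..n} 3. (\<Sum>e\<in>nsets T 2. log 3 (real (card (t e)))) - 3 * log 3 2)"
proof -
  have "(\<Sum>T\<in>nsets {1..n} 3. (\<Sum>e\<in>nsets T 2. log 3 (real (card (t e)))) - 3 * log 3 2)
      = (\<Sum>T\<in>nsets {1..n} 3. \<Sum>e\<in>nsets T 2. log 3 (real (card (t e))) - log 3 2)"
    by (intro sum.cong refl) (auto simp: sum_nsets_2_triple elim!: nsets_3_triple)
  also have "\<dots> = real (n - 2) * (\<Sum>e\<in>Kn_edges n. log 3 (real (card (t e))) - log 3 2)"
    by (subst sum_nsets_3_2) (auto simp: Kn_edges_def)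
  also have "\<dots> = (real n - 2) * (Ent n t - log 3 2 * real (n choose 2))"
    using assms by (simp add: Ent_def sum_subtractf card_Kn_edges mult.commute)
  finally show ?thesis by simp
qed

lemma Ent_le:
  assumes n: "n \<ge> 3" and t: "t \<in> templates n" and rf: "realisations n t \<subseteq> rainbow_free n"
  shows "Ent n t \<le> log 3 2 * real (n choose 2)"
proof -
  have "(real n - 2) * (Ent n t - log 3 2 * real (n choose 2)) \<le> 0"
    unfolding Ent_eq_triangle_sum[OF n]
    by (intro sum_nonpos) (use triangle_entropy(1)[OF t rf] in \<open>auto elim!: nsets_3_triple\<close>)
  then show ?thesis
    using n by (simp add: mult_le_0_iff)
qed

lemma extremal_template_triangle:
  assumes n: "n \<ge> 3" and t: "t \<in> templates n" and rf: "realisations n t \<subseteq> rainbow_free n"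
    and Ent: "Ent n t = log 3 2 * real (n choose 2)"
    and V: "x \<in> {1..n}" "y \<in> {1..n}" "z \<in> {1..n}" "x \<noteq> y" "x \<noteq> z" "y \<noteq> z"
  shows "t {x, y} = t {x, z} \<and> card (t {x, y}) = 2"
proof -
  let ?g = "\<lambda>T. (\<Sum>e\<in>nsets T 2. log 3 (real (card (t e)))) - 3 * log 3 2"
  \<comment> \<open>The deviations are negated so that a vanishing sum of nonnegative terms forces
    every term to vanish.\<close>
  have "(\<Sum>T\<in>nsets {1..n} 3. - ?g T) = 0"
    unfolding sum_negf Ent_eq_triangle_sum[OF n, of t, symmetric] Ent by simp
  moreover have "- ?g T \<ge> 0" if "T \<in> nsets {1..n} 3" for T
    using that triangle_entropy(1)[OF t rf] by (auto elim!: nsets_3_triple)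
  moreover have "finite (nsets {1..n} 3)"
    by (simp add: finite_imp_finite_nsets)
  moreover have "{x, y, z} \<in> nsets {1..n} 3"
    using V by (auto simp: nsets_def)
  ultimately have "- ?g {x, y, z} = 0"
    by (subst (asm) sum_nonneg_eq_0_iff) blast+
  then show ?thesis
    using triangle_entropy(2)[OF t rf V] by force
qed

lemma extremal_template_constant:
  assumes n: "n \<ge> 3" and t: "t \<in> templates n" and rf: "realisations n t \<subseteq> rainbow_free n"
    and Ent: "Ent n t = log 3 2 * real (n choose 2)"
  obtains c\<^sub>1 c\<^sub>2 where "c\<^sub>1 \<in> colours" "c\<^sub>2 \<in> colours" "c\<^sub>1 \<noteq> c\<^sub>2"
    "t = (\<lambda>e \<in> Kn_edges n. {c\<^sub>1, c\<^sub>2})"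
proof -
  note tri = extremal_template_triangle[OF n t rf Ent]
  \<comment> \<open>Allowing \<open>y = z\<close> covers the degenerate cases \<open>y = 1\<close>
    and \<open>x = 2\<close> in the chain below.\<close>
  have adj: "t {x, y} = t {x, z}"
    if "x \<in> {1..n}" "y \<in> {1..n}" "z \<in> {1..n}" "x \<noteq> y" "x \<noteq> z" for x y z
    using that tri[of x y z] by (cases "y = z") auto
  have const: "t e = t {1, 2}" if e: "e \<in> Kn_edges n" for e
  proof -
    \<comment> \<open>One endpoint of \<open>e\<close> differs from 1; call it \<open>x\<close>.
      Then \<open>e\<close>, \<open>{1, x}\<close>, \<open>{1, 2}\<close> is a chain in which
      consecutive edges share a vertex.\<close>
    obtain x y where xy: "e = {x, y}" "x \<in> {1..n}" "y \<in> {1..n}" "x \<noteq> y" "x \<noteq> 1"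
      using e by (auto simp: Kn_edges_def nsets_def card_2_iff) (metis insert_commute)
    have "t {x, y} = t {1, x}"
      using adj[of x y 1] xy n by (simp add: insert_commute)
    also have "\<dots> = t {1, 2}"
      using adj[of 1 x 2] xy n by simp
    finally show ?thesis
      using xy by simp
  qed
  have "card (t {1, 2}) = 2"
    using tri[of 1 2 3] n by force
  then obtain c\<^sub>1 c\<^sub>2 where c: "t {1, 2} = {c\<^sub>1, c\<^sub>2}" "c\<^sub>1 \<noteq> c\<^sub>2"
    by (auto simp: card_2_iff)
  have "{1, 2} \<in> Kn_edges n"
    using n by (simp add: Kn_edges_doubleton_iff)
  then have "t {1, 2} \<subseteq> colours"
    using t by (auto simp: templates_def)
  \<comment> \<open>Off the edge set both functions are \<open>undefined\<close>, so agreement on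
    edges gives equality.\<close>
  moreover have "t = (\<lambda>e \<in> Kn_edges n. {c\<^sub>1, c\<^sub>2})"
    using t const c unfolding templates_def by (intro extensionalityI[of _ "Kn_edges n"]) (auto simp: PiE_def)
  ultimately show ?thesis
    using that c by auto
qed

text \<open>With two colours available, two of the three edges of any triangle agree.\<close>

lemma pair_template:
  fixes n :: nat
  assumes "c\<^sub>1 \<in> colours" "c\<^sub>2 \<in> colours" "c\<^sub>1 \<noteq> c\<^sub>2"
  defines "t \<equiv> (\<lambda>e \<in> Kn_edges n. {c\<^sub>1, c\<^sub>2})"
  shows "t \<in> templates n" "realisations n t \<subseteq> rainbow_free n"
    "Ent n t = log 3 2 * real (n choose 2)"
proof -
  show "t \<in> templates n"
    using assms by (auto simp: templates_def)
  show "Ent n t = log 3 2 * real (n choose 2)"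
    using assms by (simp add: Ent_def card_Kn_edges)
  show "realisations n t \<subseteq> rainbow_free n"
  proof
    fix k assume k: "k \<in> realisations n t"
    have two: "k {x, y} = c\<^sub>1 \<or> k {x, y} = c\<^sub>2"
      if "x \<in> {1..n}" "y \<in> {1..n}" "x \<noteq> y" for x y
    proof -
      have "{x, y} \<in> Kn_edges n"
        using that by (simp add: Kn_edges_doubleton_iff)
      then show ?thesis
        using k by (auto simp: realisations_def t_def)
    qed
    have "\<not> rainbow_triangle k x y z"
      if "x \<in> {1..n}" "y \<in> {1..n}" "z \<in> {1..n}" for x y z
      using two[of x y] two[of x z] two[of y z] that unfolding rainbow_triangle_def by metis
    then show "k \<in> rainbow_free n"
      using k by (auto simp: rainbow_free_def realisations_def)
  qed
qed

theorem theorem4p13: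
  fixes n :: nat
  assumes "n \<ge> 3"
  shows "ex n rainbow_free = log 3 2 * real (n choose 2) \<and>
    {t \<in> templates n. realisations n t \<subseteq> rainbow_free n \<and>
        Ent n t = log 3 2 * real (n choose 2)} =
      {(\<lambda>e \<in> Kn_edges n. {c\<^sub>1, c\<^sub>2}) | c\<^sub>1 c\<^sub>2.
        c\<^sub>1 \<in> colours \<and> c\<^sub>2 \<in> colours \<and> c\<^sub>1 \<noteq> c\<^sub>2}"
proof
  \<comment> \<open>Any pair would do as the witness that the maximum is attained.\<close>
  have colours12: "1 \<in> colours" "2 \<in> colours" "(1::nat) \<noteq> 2"
    by (auto simp: colours_def)
  show "ex n rainbow_free = log 3 2 * real (n choose 2)"
    unfolding ex_def
  proof (rule Max_eqI)
    \<comment> \<open>\<open>Max\<close> is only meaningful on a finite set, hence the detour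
      through the finitely many templates.\<close>
    have "{Ent n t | t. t \<in> templates n \<and> realisations n t \<subseteq> rainbow_free n}
        \<subseteq> Ent n ` templates n"
      by blast
    then show "finite {Ent n t | t. t \<in> templates n \<and> realisations n t \<subseteq> rainbow_free n}"
      using finite_templates finite_surj by blast
  next
    fix s assume "s \<in> {Ent n t | t. t \<in> templates n \<and> realisations n t \<subseteq> rainbow_free n}"
    then show "s \<le> log 3 2 * real (n choose 2)"
      using Ent_le[OF assms] by blast
  next
    show "log 3 2 * real (n choose 2)
        \<in> {Ent n t | t. t \<in> templates n \<and> realisations n t \<subseteq> rainbow_free n}"
      using pair_template[OF colours12, of n] by (smt (verit) mem_Collect_eq)
  qed
  show "{t \<in> templates n. realisations n t \<subseteq> rainbow_free n \<and>
        Ent n t = log 3 2 * real (n choose 2)} =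
      {(\<lambda>e \<in> Kn_edges n. {c\<^sub>1, c\<^sub>2}) | c\<^sub>1 c\<^sub>2.
        c\<^sub>1 \<in> colours \<and> c\<^sub>2 \<in> colours \<and> c\<^sub>1 \<noteq> c\<^sub>2}"
    using pair_template[of _ _ n] by (blast elim: extremal_template_constant[OF assms])
qed

end
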